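(* Let $n$ be a positive integer and let $k,l,m$ be integers with $1\le k<l\le m\le n$. Let $M$ be the $n\times n$ strictly upper triangular matrix of the $c(k,l)$-$r(l-1,m)$-formation, that is, $M(i,l)=2$ for $k\le i\le l-1$, $M(l-1,j)=2$ for $l\le j\le m$, and all other entries are $0$. Let $M_1$ be the $n\times n$ matrix with $M_1(l-2,l+1)=2$ and all other entries zero, and let $M_2$ be the $n\times n$ matrix with $M_2(l-2,l+2)=2$ and all other entries zero. (1) If $l-k\ge 2$ and $m-l\ge 1$, then $M+M_1$ is CN-realizable. (2) If $l-k\ge 2$ and $m-l\ge 2$, then $M+M_1+M_2$ is CN-realizable.
   Context: An $n$-braid projection $B$ consists of $n$ strands in the plane, each running monotonically downward from one of $n$ points on an upper horizontal bar to one of $n$ points on a lower horizontal bar, meeting each other only in finitely many transverse double points (crossings), with no over/under information. The strands are named $s_1,\dots,s_n$ from left to right at the top. Combinatorially, $B$ is encoded by a finite word with letters in $\{1,\dots,n-1\}$: reading from top to bottom, the letter $k$ means that the two strands currently in positions $k$ and $k+1$ cross once and exchange positions (no reduction is assumed). The CN matrix $N(B)$ is the symmetric zero-diagonal $n\times n$ matrix whose $(i,j)$ entry ($i\neq j$) is the number of crossings between $s_i$ and $s_j$. CN matrices are represented by strictly upper triangular matrices: a strictly upper triangular $n\times n$ matrix $M$ is CN-realizable if there is an $n$-braid projection $B$ with $M(i,j)=N(B)(i,j)$ for all $1\le i<j\le n$. (The matrix $M_2$ is only considered in part (2), and $M_1$ only in parts (1) and (2), where the indicated positions exist.) *)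

theory Defs
  imports
    Jordan_Normal_Form.Matrix
    "HOL-Combinatorics.Transposition"
begin

(* Library matrices are indexed from 0; strands and matrix entries are numbered from 1 here. *)

definition mat1 :: "nat \<Rightarrow> (nat \<Rightarrow> nat \<Rightarrow> 'a) \<Rightarrow> 'a mat" where
  "mat1 n f = mat n n (\<lambda>(i, j). f (Suc i) (Suc j))"

definition entry1 :: "'a mat \<Rightarrow> nat \<Rightarrow> nat \<Rightarrow> 'a" where
  "entry1 A i j = A $$ (i - 1, j - 1)"

definition strictly_upper_triangular :: "'a::zero mat \<Rightarrow> bool" where
  "strictly_upper_triangular A \<longleftrightarrow>
     upper_triangular A \<and> (\<forall>i < dim_row A. A $$ (i, i) = 0)"

(* A braid projection is encoded by its crossings from top to bottom: the letter k stands for a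
   crossing of the strands in positions k and k+1. *)

definition braid_projections :: "nat \<Rightarrow> nat list set" where
  "braid_projections n = lists {1..<n}"

(* p maps each position to the strand currently occupying it. *)

fun crossings_from :: "(nat \<Rightarrow> nat) \<Rightarrow> nat list \<Rightarrow> nat \<Rightarrow> nat \<Rightarrow> nat" where
  "crossings_from p [] i j = 0"
| "crossings_from p (k # B) i j =
     (if {p k, p (Suc k)} = {i, j} then 1 else 0)
     + crossings_from (p \<circ> transpose k (Suc k)) B i j"

definition crossings :: "nat list \<Rightarrow> nat \<Rightarrow> nat \<Rightarrow> nat" where
  "crossings B = crossings_from id B"

definition CN_matrix :: "nat \<Rightarrow> nat list \<Rightarrow> nat mat" where
  "CN_matrix n B = mat1 n (\<lambda>i j. if i = j then 0 else crossings B i j)"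

definition CN_realizable :: "nat \<Rightarrow> nat mat \<Rightarrow> bool" where
  "CN_realizable n M \<longleftrightarrow>
     M \<in> carrier_mat n n \<and> strictly_upper_triangular M \<and>
     (\<exists>B \<in> braid_projections n.
        \<forall>i j. 1 \<le> i \<and> i < j \<and> j \<le> n \<longrightarrow> entry1 M i j = entry1 (CN_matrix n B) i j)"

(* The c(k,l)-r(l-1,m)-formation: its column and row parts share the entry (l-1,l), which is 2. *)

definition formation_matrix :: "nat \<Rightarrow> nat \<Rightarrow> nat \<Rightarrow> nat \<Rightarrow> nat mat" where
  "formation_matrix n k l m = mat1 n (\<lambda>i j.
     if (k \<le> i \<and> i \<le> l - 1 \<and> j = l) \<or> (i = l - 1 \<and> l \<le> j \<and> j \<le> m) then 2 else 0)"

definition single_two :: "nat \<Rightarrow> nat \<Rightarrow> nat \<Rightarrow> nat mat" where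
  "single_two n a b = mat1 n (\<lambda>i j. if i = a \<and> j = b then 2 else 0)"

end

theory Submission
  imports Defs
begin

text \<open>Let \<open>W\<close> cross the strands \<open>l - 1\<close> and \<open>l\<close>, move \<open>l\<close> left to position \<open>k\<close> and \<open>l - 1\<close> right
  to position \<open>m\<close>. Now the strands \<open>l - 2\<close> and \<open>l + 1\<close> are adjacent, in positions \<open>l - 1\<close> and \<open>l\<close>,
  and \<open>l + 2\<close> follows if \<open>m \<ge> l + 2\<close>. So strand \<open>l - 2\<close> crosses \<open>l + 1\<close> by the letter \<open>l - 1\<close> and
  then \<open>l + 2\<close> by the letter \<open>l\<close>. Running the word and then its reversal doubles every crossing
  number, which gives the required entries \<open>2\<close>.\<close>

definition strands_after :: "(nat \<Rightarrow> nat) \<Rightarrow> nat list \<Rightarrow> nat \<Rightarrow> nat" where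
  "strands_after = foldl (\<lambda>p k. p \<circ> transpose k (Suc k))"

lemma strands_after_simps [simp]:
  "strands_after p [] = p"
  "strands_after p (k # B) = strands_after (p \<circ> transpose k (Suc k)) B"
  "strands_after p (A @ B) = strands_after (strands_after p A) B"
  by (simp_all add: strands_after_def)

lemma crossings_from_append:
  "crossings_from p (A @ B) i j = crossings_from p A i j + crossings_from (strands_after p A) B i j"
  by (induction A arbitrary: p) auto

text \<open>Each letter acts by an involution, so the reversed word undoes the letters one by one,
  the last one first.\<close>

lemma strands_after_rev: "strands_after (strands_after p B) (rev B) = p"
  by (induction B arbitrary: p) (auto simp: o_assoc[symmetric])

text \<open>The reversed word is the vertical mirror image of \<open>B\<close>: started from the
  bottom of \<open>B\<close>, it meets every crossing again, between the same two strands.\<close>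

lemma crossings_from_rev:
  "crossings_from (strands_after p B) (rev B) i j = crossings_from p B i j"
proof (induction B arbitrary: p)
  case (Cons k B)
  show ?case
    by (simp add: crossings_from_append Cons.IH strands_after_rev insert_commute comp_def)
qed simp

lemma crossings_palindrome: "crossings (B @ rev B) i j = 2 * crossings B i j"
  by (simp add: crossings_def crossings_from_append crossings_from_rev)

text \<open>Reduces realizability to half a braid: the witness is the palindrome
  \<open>B @ rev B\<close>. Vanishing on and below the diagonal yields strict upper
  triangularity.\<close>

lemma CN_realizable_mat1I:
  assumes "B \<in> lists {1..<n}"
    and "\<And>i j. j \<le> i \<Longrightarrow> f i j = 0"
    and "\<And>i j. 1 \<le> i \<Longrightarrow> i < j \<Longrightarrow> j \<le> n \<Longrightarrow> f i j = 2 * crossings B i j"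
  shows "CN_realizable n (mat1 n f)"
  unfolding CN_realizable_def
proof (intro conjI bexI)
  show "mat1 n f \<in> carrier_mat n n"
    by (simp add: mat1_def)
  show "strictly_upper_triangular (mat1 n f)"
    using assms(2) by (auto simp: strictly_upper_triangular_def mat1_def)
  show "B @ rev B \<in> braid_projections n"
    using assms(1) by (auto simp: braid_projections_def)
  show "\<forall>i j. 1 \<le> i \<and> i < j \<and> j \<le> n \<longrightarrow>
      entry1 (mat1 n f) i j = entry1 (CN_matrix n (B @ rev B)) i j"
    using assms(3) by (auto simp: entry1_def CN_matrix_def mat1_def crossings_palindrome)
qed

lemma strands_after_right:
  assumes "x \<le> m"
  shows "strands_after p [x..<m] =
    (\<lambda>y. if y = m then p x else if x \<le> y \<and> y < m then p (Suc y) else p y)"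
  using assms by (induction m rule: dec_induct) (auto simp: transpose_def fun_eq_iff)

text \<open>One strand takes part in every crossing: at letter \<open>y\<close> it has arrived in
  position \<open>y\<close>, while position \<open>Suc y\<close> still holds its initial
  strand.\<close>

lemma crossings_from_right:
  assumes "x \<le> m"
  shows "crossings_from p [x..<m] i j = (\<Sum>y=x..<m. if {p x, p (Suc y)} = {i, j} then 1 else 0)"
  using assms
  by (induction m rule: dec_induct) (auto simp: crossings_from_append strands_after_right)

lemma strands_after_left:
  assumes "k \<le> x"
  shows "strands_after p (rev [k..<x]) =
    (\<lambda>y. if y = k then p x else if k < y \<and> y \<le> x then p (y - 1) else p y)"
  using assms
proof (induction x arbitrary: p rule: dec_induct)
  case (step x)
  then show ?case by (auto simp: transpose_def fun_eq_iff)
qed (auto simp: fun_eq_iff)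

lemma crossings_from_left:
  assumes "k \<le> x"
  shows "crossings_from p (rev [k..<x]) i j = (\<Sum>y=k..<x. if {p y, p x} = {i, j} then 1 else 0)"
  using assms
proof (induction x arbitrary: p rule: dec_induct)
  case (step x)
  \<comment> \<open>The first letter \<open>x\<close> brings the moving strand from
    \<open>Suc x\<close> to \<open>x\<close> and fixes all positions below \<open>x\<close>, so the
    induction hypothesis for the changed placement gives the remaining terms.\<close>
  have "(\<Sum>y=k..<x. if {(p \<circ> transpose x (Suc x)) y, (p \<circ> transpose x (Suc x)) x} = {i, j} then 1 else 0)
      = (\<Sum>y=k..<x. if {p y, p (Suc x)} = {i, j} then 1 else 0 :: nat)"
    by (intro sum.cong) (auto simp: transpose_def)
  with step show ?case by simp
qed simp

text \<open>The first letter puts strand \<open>l\<close> in position \<open>l - 1\<close> and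
  strand \<open>l - 1\<close> in position \<open>l\<close>, which is where the two runs
  start.\<close>

definition formation_half :: "nat \<Rightarrow> nat \<Rightarrow> nat \<Rightarrow> nat list" where
  "formation_half k l m = (l - 1) # rev [k..<l - 1] @ [l..<m]"

lemma strands_after_formation_half:
  assumes "1 \<le> k" "k < l" "l \<le> m"
  shows "strands_after id (formation_half k l m) =
    (\<lambda>y. if y = k then l else if k < y \<and> y < l then y - 1
         else if y = m then l - 1 else if l \<le> y \<and> y < m then Suc y else y)"
  using assms
  by (auto simp: formation_half_def strands_after_left strands_after_right transpose_def fun_eq_iff)

lemma doubleton_eq_ordered_iff:
  fixes a b i j :: "'a::linorder"
  assumes "a < b" "i < j"
  shows "{a, b} = {i, j} \<longleftrightarrow> i = a \<and> j = b"
  using assms by (auto simp: doubleton_eq_iff)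

text \<open>The first letter accounts for the entry shared by column and row, the leftward run for
  the rest of the column, the rightward run for the rest of the row.\<close>

lemma crossings_formation_half:
  assumes "1 \<le> k" "k < l" "l \<le> m" "i < j"
  shows "crossings (formation_half k l m) i j =
    (if (k \<le> i \<and> i \<le> l - 1 \<and> j = l) \<or> (i = l - 1 \<and> l \<le> j \<and> j \<le> m) then 1 else 0)"
proof -
  let ?p = "transpose (l - 1) l"
  let ?q = "strands_after ?p (rev [k..<l - 1])"
  have "k \<le> l - 1"
    using assms by simp
  \<comment> \<open>Below position \<open>l - 1\<close> every strand is still in its own place, so
    letter \<open>y\<close> crosses strands \<open>y\<close> and \<open>l\<close>. The nested
    conditionals make this a sum with at most one nonzero term.\<close>
  have "crossings_from ?p (rev [k..<l - 1]) i j
      = (\<Sum>y=k..<l - 1. if y = i then if j = l then 1 else 0 else 0)"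
    unfolding crossings_from_left[OF \<open>k \<le> l - 1\<close>]
    by (intro sum.cong) (use assms in \<open>auto simp: doubleton_eq_iff transpose_def\<close>)
  then have left: "crossings_from ?p (rev [k..<l - 1]) i j = (if k \<le> i \<and> i < l - 1 \<and> j = l then 1 else 0)"
    using assms by auto
  \<comment> \<open>The leftward run only touches positions up to \<open>l - 1\<close>.\<close>
  have q: "?q l = l - 1" "\<And>y. l \<le> y \<Longrightarrow> ?q (Suc y) = Suc y"
    using assms(1-3) by (auto simp: strands_after_left transpose_def)
  \<comment> \<open>Letter \<open>y\<close> meets strand \<open>Suc y\<close>, so the term counted
    for \<open>j\<close> has the index \<open>j - 1\<close>.\<close>
  obtain j' where j': "j = Suc j'"
    using \<open>i < j\<close> less_imp_Suc_add by blast
  have "crossings_from ?q [l..<m] i j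
      = (\<Sum>y=l..<m. if y = j' then if i = l - 1 then 1 else 0 else 0)"
    unfolding crossings_from_right[OF \<open>l \<le> m\<close>]
  proof (intro sum.cong refl)
    fix y assume "y \<in> {l..<m}"
    then have "?q (Suc y) = Suc y" and "l - 1 < Suc y"
      using q(2) by auto
    then have "{?q l, ?q (Suc y)} = {i, j} \<longleftrightarrow> i = l - 1 \<and> y = j'"
      unfolding q(1) using doubleton_eq_ordered_iff[OF _ \<open>i < j\<close>] j' by auto
    then show "(if {?q l, ?q (Suc y)} = {i, j} then 1 else 0 :: nat)
        = (if y = j' then if i = l - 1 then 1 else 0 else 0)"
      by simp
  qed
  then have right: "crossings_from ?q [l..<m] i j = (if i = l - 1 \<and> l < j \<and> j \<le> m then 1 else 0)"
    unfolding j' by simp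
  have "Suc (l - 1) = l"
    using assms by simp
  then have "crossings (formation_half k l m) i j = (if {l - 1, l} = {i, j} then 1 else 0)
      + crossings_from ?p (rev [k..<l - 1]) i j + crossings_from ?q [l..<m] i j"
    by (simp add: crossings_def formation_half_def crossings_from_append)
  then show ?thesis
    unfolding left right using assms by (auto simp: doubleton_eq_iff)
qed

theorem proposition16:
  fixes n k l m :: nat and M M\<^sub>1 M\<^sub>2 :: "nat mat"
  assumes "1 \<le> n" and "1 \<le> k" and "k < l" and "l \<le> m" and "m \<le> n"
  defines "M \<equiv> formation_matrix n k l m"
    and "M\<^sub>1 \<equiv> single_two n (l - 2) (l + 1)"
    and "M\<^sub>2 \<equiv> single_two n (l - 2) (l + 2)"
  shows "(l - k \<ge> 2 \<and> m - l \<ge> 1 \<longrightarrow> CN_realizable n (M + M\<^sub>1)) \<and>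
         (l - k \<ge> 2 \<and> m - l \<ge> 2 \<longrightarrow> CN_realizable n (M + M\<^sub>1 + M\<^sub>2))"
proof -
  let ?W = "formation_half k l m"
  let ?f = "\<lambda>i j. if (k \<le> i \<and> i \<le> l - 1 \<and> j = l) \<or> (i = l - 1 \<and> l \<le> j \<and> j \<le> m) then 2 else 0 :: nat"
  let ?s = "\<lambda>b i j. if i = l - 2 \<and> j = b then 2 else 0 :: nat"
  let ?P = "strands_after id ?W"
  have [simp]: "Suc (l - 1) = l" "Suc l \<noteq> l - 1" "l - 2 < l + 1" "l - 2 < l + 2"
    using assms by auto
  \<comment> \<open>Since \<open>k < l - 1\<close>, strand \<open>l - 2\<close> has been pushed
    right into position \<open>l - 1\<close>; since \<open>l < m\<close>, strand
    \<open>l + 1\<close> has been pushed left into position \<open>l\<close>.\<close>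
  have P: "?P (l - 1) = l - 2" "?P l = l + 1" if "l - k \<ge> 2" "m - l \<ge> 1"
    using assms that by (auto simp: strands_after_formation_half)
  have P': "?P (Suc l) = l + 2" if "m - l \<ge> 2"
    using assms that by (auto simp: strands_after_formation_half)
  have W: "?W \<in> lists {1..<n}" if "l < m"
    using assms that by (auto simp: formation_half_def)
  have "CN_realizable n (M + M\<^sub>1)" if "l - k \<ge> 2" "m - l \<ge> 1"
  proof -
    have "CN_realizable n (mat1 n (\<lambda>i j. ?f i j + ?s (l + 1) i j))"
    proof (rule CN_realizable_mat1I)
      show "?W @ [l - 1] \<in> lists {1..<n}"
        using assms that W by auto
      show "?f i j + ?s (l + 1) i j = 2 * crossings (?W @ [l - 1]) i j" if "i < j" for i j
      proof -
        have "crossings (?W @ [l - 1]) i j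
            = crossings ?W i j + (if {l - 2, l + 1} = {i, j} then 1 else 0)"
          using P \<open>l - k \<ge> 2\<close> \<open>m - l \<ge> 1\<close>
          by (simp add: crossings_def crossings_from_append del: One_nat_def)
        then show ?thesis
          using assms that by (simp add: crossings_formation_half doubleton_eq_ordered_iff)
      qed
    qed (use assms in auto)
    also have "mat1 n (\<lambda>i j. ?f i j + ?s (l + 1) i j) = M + M\<^sub>1"
      by (rule eq_matI) (simp_all add: M_def M\<^sub>1_def formation_matrix_def single_two_def mat1_def)
    finally show ?thesis .
  qed
  moreover have "CN_realizable n (M + M\<^sub>1 + M\<^sub>2)" if "l - k \<ge> 2" "m - l \<ge> 2"
  proof -
    have "CN_realizable n (mat1 n (\<lambda>i j. ?f i j + ?s (l + 1) i j + ?s (l + 2) i j))"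
    proof (rule CN_realizable_mat1I)
      show "?W @ [l - 1, l] \<in> lists {1..<n}"
        using assms that W by auto
      show "?f i j + ?s (l + 1) i j + ?s (l + 2) i j = 2 * crossings (?W @ [l - 1, l]) i j"
        if "i < j" for i j
      proof -
        \<comment> \<open>The added letter \<open>l - 1\<close> moves strand \<open>l - 2\<close> to
          position \<open>l\<close>, next to strand \<open>l + 2\<close> in position
          \<open>l + 1\<close>; the letter \<open>l\<close> then crosses these two.\<close>
        have "crossings (?W @ [l - 1, l]) i j = crossings ?W i j
            + (if {l - 2, l + 1} = {i, j} then 1 else 0) + (if {l - 2, l + 2} = {i, j} then 1 else 0)"
          using P P' \<open>l - k \<ge> 2\<close> \<open>m - l \<ge> 2\<close> assms
          by (simp add: crossings_def crossings_from_append transpose_def del: One_nat_def)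
        then show ?thesis
          using assms that by (simp add: crossings_formation_half doubleton_eq_ordered_iff)
      qed
    qed (use assms in auto)
    also have "mat1 n (\<lambda>i j. ?f i j + ?s (l + 1) i j + ?s (l + 2) i j) = M + M\<^sub>1 + M\<^sub>2"
      by (rule eq_matI)
        (simp_all add: M_def M\<^sub>1_def M\<^sub>2_def formation_matrix_def single_two_def mat1_def)
    finally show ?thesis .
  qed
  ultimately show ?thesis by blast
qed

end
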